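(* Let $\Lambda$ be a Borel subset of $\mathbb R^d$, $d\ge1$, and let $\mathfrak m$ be a Borel measure with $0<\mathfrak m(\Lambda)<+\infty$. Let $X$ be a separable $F$-space, let $(T_\lambda)_{\lambda\in\Lambda}$ be a family of operators on $X$ such that $\lambda\mapsto T_\lambda u$ is continuous for all $u\in X$, and let $\psi\in\Psi^*$. Assume that, for all $u\in X$, there are a non-empty open set $V\subset X$ and $c>0$ such that $$\forall\, n\gg1,\quad \mathfrak m(\{\lambda\in\Lambda: n\in N_\lambda(u,V)\})\le\frac{c}{\psi(n)} .$$ Then $(T_\lambda)_{\lambda\in\Lambda}$ has no common upper frequently hypercyclic vector.
   Context: An operator on $X$ is a continuous linear map $X\to X$. $N_\lambda(u,V)=\{n\in\mathbb N_0: T_\lambda^nu\in V\}$. "$\forall n\gg1$" means for all $n\ge n_0$ for some $n_0\in\mathbb N$. For $A\subset\mathbb N_0$, $\overline d(A)=\limsup_{n\to\infty}\frac{\#(A\cap[0,n])}{n+1}$. A vector $u\in X$ is upper frequently hypercyclic for $T$ if $\overline d(\{k\in\mathbb N_0:T^ku\in U\})>0$ for every non-empty open $U\subset X$; a common upper frequently hypercyclic vector for $(T_\lambda)_{\lambda\in\Lambda}$ is a vector that is upper frequently hypercyclic for every $T_\lambda$. $\Psi$ is the family of all non-decreasing functions $\psi:(0,+\infty)\to(0,+\infty)$ for which there exists $\eta>0$ such that: (I) for any $t>0$, the sequence $\big(\frac{\psi(n)}{\psi(tn)}\big)_{n\ge1}$ is bounded; (II) $\lim_{n\to+\infty}\psi(n)=+\infty$;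 (III) there is $t_0>0$ such that $\psi\in\mathcal C^1(t_0,+\infty)$ and $\frac{\psi(t)}{\psi'(t)}\ge(1+\eta)t$ for all $t>t_0$ (that is, $(1+\eta)t\,\psi'(t)\le\psi(t)$). $\Psi^*$ is the set of $\psi\in\Psi$ for which there exists $\gamma\in\mathbb N$ with (IV) $\sum_{n\ge1}\frac1{\psi(\gamma^n)}<+\infty$. *)

theory Defs
  imports "HOL-Analysis.Analysis"
begin

text \<open>
  The scalar field is any real normed field; by Gelfand-Mazur these are, up to isomorphism,
  exactly the reals and the complex numbers. The type class of \<open>'a\<close> supplies the complete metric.
  Continuity of addition follows from translation invariance.
\<close>

locale F_space = vector_space smul
  for smul :: "'k::real_normed_field \<Rightarrow> 'a::{ab_group_add, complete_space} \<Rightarrow> 'a" +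
  assumes dist_translation: "\<And>x y z :: 'a. dist (x + z) (y + z) = dist x y"
    and continuous_scale: "continuous_on UNIV (\<lambda>(a, x). smul a x)"

definition operator_on ::
  "('k::real_normed_field \<Rightarrow> 'a::{ab_group_add, complete_space} \<Rightarrow> 'a) \<Rightarrow> ('a \<Rightarrow> 'a) \<Rightarrow> bool" where
  "operator_on smul S \<longleftrightarrow> Vector_Spaces.linear smul smul S \<and> continuous_on UNIV S"

definition visit_times :: "('a \<Rightarrow> 'a) \<Rightarrow> 'a \<Rightarrow> 'a set \<Rightarrow> nat set" where
  "visit_times S u V = {n. (S ^^ n) u \<in> V}"

definition upper_density :: "nat set \<Rightarrow> ereal" where
  "upper_density A = limsup (\<lambda>n. ereal (real (card (A \<inter> {0..n})) / real (n + 1)))"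

definition upper_frequently_hypercyclic :: "('a::topological_space \<Rightarrow> 'a) \<Rightarrow> 'a \<Rightarrow> bool" where
  "upper_frequently_hypercyclic S u \<longleftrightarrow>
     (\<forall>U. open U \<and> U \<noteq> {} \<longrightarrow> upper_density (visit_times S u U) > 0)"

definition common_upper_frequently_hypercyclic ::
  "'l set \<Rightarrow> ('l \<Rightarrow> 'a::topological_space \<Rightarrow> 'a) \<Rightarrow> 'a \<Rightarrow> bool" where
  "common_upper_frequently_hypercyclic \<Lambda> T u \<longleftrightarrow>
     (\<forall>l\<in>\<Lambda>. upper_frequently_hypercyclic (T l) u)"

text \<open>
  Functions on the open half-line are represented by total functions on the reals; the values
  at non-positive arguments are arbitrary and never constrained.
  The inequality \<open>\<psi> t / \<psi>' t \<ge> (1 + \<eta>) t\<close> is written without division, since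
  \<open>\<psi>' t\<close> may vanish.
\<close>

definition Psi :: "(real \<Rightarrow> real) set" where
  "Psi = {\<psi>. (\<forall>t>0. \<psi> t > 0) \<and> mono_on {0<..} \<psi> \<and>
     (\<exists>\<eta>>0.
        (\<forall>t>0. bounded ((\<lambda>n::nat. \<psi> (real n) / \<psi> (t * real n)) ` {1..})) \<and>
        filterlim (\<lambda>n::nat. \<psi> (real n)) at_top sequentially \<and>
        (\<exists>t0>0. \<psi> C1_differentiable_on {t0<..} \<and>
           (\<forall>t>t0. (1 + \<eta>) * t * deriv \<psi> t \<le> \<psi> t)))}"

text \<open>
  \<open>\<gamma> \<ge> 1\<close> keeps \<open>\<gamma> ^ n\<close> in the domain of \<open>\<psi>\<close>; the \<open>Suc\<close> starts the sum at index 1.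
\<close>

definition Psi_star :: "(real \<Rightarrow> real) set" where
  "Psi_star = {\<psi> \<in> Psi. \<exists>\<gamma>::nat. \<gamma> \<ge> 1 \<and> summable (\<lambda>n. 1 / \<psi> (real (\<gamma> ^ Suc n)))}"

end

theory Submission
  imports Defs
begin

text \<open>
  Suppose \<open>u\<close> is a common upper frequently hypercyclic vector, and let \<open>V\<close> be the open set that
  the hypothesis attaches to \<open>u\<close>. Write \<open>A n\<close> for the set of parameters whose orbit of \<open>u\<close> is in
  \<open>V\<close> at time \<open>n\<close>. The integral over \<open>\<Lambda>\<close> of the proportion of visit times up to
  \<open>N\<close> is the average of the measures of \<open>A 0, \<dots>, A N\<close>, and it is shown that these averages are
  so small along \<open>N = \<gamma> ^ k\<close> that for almost every parameter the visit times have density zero. As \<open>\<Lambda>\<close> has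
  positive measure, some parameter contradicts the choice of \<open>u\<close>.

  Three points carry the argument.

  The averages are of order \<open>1 / \<psi> N\<close>, that is, up to a constant no larger than the bound on
  the single set \<open>A N\<close>. This is where \<open>\<psi>\<close> must grow at a rate below linear: the derivative of
  \<open>t / \<psi> t\<close> is \<open>(\<psi> t - t \<psi>' t) / (\<psi> t)\<^sup>2\<close>, and condition (III) makes it at least a constant
  times \<open>1 / \<psi> t\<close>. Hence the partial sums of \<open>1 / \<psi> n\<close> are dominated by the telescoping sum of the
  increments of \<open>t / \<psi> t\<close> (\<open>Psi_partial_sums\<close>, \<open>Psi_sum_bound\<close>).

  Condition (IV) then makes the averages along \<open>\<gamma> ^ k\<close> summable, so for almost every parameter the
  proportions along \<open>\<gamma> ^ k\<close> are summable and tend to zero; passing from powers of \<open>\<gamma>\<close> to all \<open>N\<close> costs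
  only a factor \<open>\<gamma>\<close> (\<open>AE_upper_density_zero\<close>, \<open>density_zero_from_powers\<close>).

  Integrating the proportions needs \<open>A n\<close> to be measurable. The parameter occurs in every factor of
  the \<open>n\<close>-th iterate, while the dependence on it is known to be continuous only at a fixed vector.
  Since the operators are continuous and the space is separable, the map
  \<open>(l, x) \<mapsto> T l x\<close> can be handled as a Caratheodory function, which yields measurability of
  \<open>l \<mapsto> (T l ^^ n) u\<close> by induction (\<open>borel_measurable_Caratheodory_compose\<close>).
\<close>

section \<open>Measurability of the visit sets\<close>

text \<open>
  Replace \<open>h l\<close> by the first point of an enumerated dense set that is within \<open>1 / (k + 1)\<close> of it.
  The resulting function of \<open>l\<close> is glued from countably many measurable pieces \<open>F l x\<close> with
  \<open>x\<close> fixed, and by continuity of \<open>F l\<close> these functions converge to the desired one as \<open>k\<close> grows.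
\<close>

lemma borel_measurable_Caratheodory_compose:
  fixes D :: "'a::metric_space set"
    and F :: "'l \<Rightarrow> 'a \<Rightarrow> 'b::metric_space"
  assumes D: "countable D" "closure D = UNIV"
    and meas: "\<And>x. (\<lambda>l. F l x) \<in> borel_measurable M"
    and cont: "\<And>l. l \<in> space M \<Longrightarrow> continuous_on UNIV (F l)"
    and h: "h \<in> borel_measurable M"
  shows "(\<lambda>l. F l (h l)) \<in> borel_measurable M"
proof -
  define d where "d = from_nat_into D"
  have "D \<noteq> {}" using D(2) by auto
  then have range_d: "range d = D"
    unfolding d_def using D(1) by (rule range_from_nat_into)
  define idx where "idx k l = (LEAST i. dist (d i) (h l) < 1 / real (Suc k))" for k l
  have close: "dist (d (idx k l)) (h l) < 1 / real (Suc k)" for k l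
  proof -
    have "h l \<in> closure (range d)" using D(2) range_d by simp
    then have "\<exists>i. dist (d i) (h l) < 1 / real (Suc k)"
      unfolding closure_approachable by (metis of_nat_0_less_iff rangeE zero_less_Suc zero_less_divide_1_iff)
    then show ?thesis unfolding idx_def by (rule LeastI_ex)
  qed
  have idx_meas: "idx k \<in> measurable M (count_space UNIV)" for k
  proof -
    have "(\<lambda>l. dist (d i) (h l) < 1 / real (Suc k)) \<in> measurable M (count_space UNIV)" for i
    proof -
      have "h -` ball (d i) (1 / real (Suc k)) \<inter> space M \<in> sets M"
        using h by (rule measurable_sets) simp
      also have "h -` ball (d i) (1 / real (Suc k)) \<inter> space M
          = {l \<in> space M. dist (d i) (h l) < 1 / real (Suc k)}" by auto
      finally show ?thesis by (simp add: pred_def)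
    qed
    then show ?thesis unfolding idx_def by (rule measurable_Least)
  qed
  have approx_meas: "(\<lambda>l. F l (d (idx k l))) \<in> borel_measurable M" for k
    by (rule measurable_compose_countable[OF meas idx_meas])
  have approx_lim: "(\<lambda>k. F l (d (idx k l))) \<longlonglongrightarrow> F l (h l)" if "l \<in> space M" for l
  proof -
    have "(\<lambda>k. dist (d (idx k l)) (h l)) \<longlonglongrightarrow> 0"
      by (rule Lim_null_comparison[OF _ LIMSEQ_Suc[OF lim_1_over_n]])
         (use close less_imp_le in \<open>auto intro!: always_eventually\<close>)
    then have "(\<lambda>k. d (idx k l)) \<longlonglongrightarrow> h l" by (rule tendsto_dist_iff[THEN iffD2])
    then show ?thesis by (rule continuous_on_tendsto_compose[OF cont[OF that]]) auto
  qed
  show ?thesis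
    by (rule borel_measurable_LIMSEQ_metric[OF approx_meas approx_lim])
qed

lemma borel_measurable_iterates:
  fixes D :: "'a::metric_space set" and T :: "'l \<Rightarrow> 'a \<Rightarrow> 'a"
  assumes "countable D" "closure D = UNIV"
    and "\<And>x. (\<lambda>l. T l x) \<in> borel_measurable M"
    and "\<And>l. l \<in> space M \<Longrightarrow> continuous_on UNIV (T l)"
  shows "(\<lambda>l. (T l ^^ n) u) \<in> borel_measurable M"
proof (induction n)
  case 0
  show ?case by simp
next
  case (Suc n)
  show ?case
    using borel_measurable_Caratheodory_compose[OF assms Suc.IH] by simp
qed

section \<open>Partial sums of the reciprocals of \<open>\<psi>\<close>\<close>

text \<open>
  With \<open>F t = t / \<psi> t\<close> and \<open>b = \<eta> / (1 + \<eta>)\<close>, condition (III) says that \<open>F' t \<ge> b / \<psi> t\<close> for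
  large \<open>t\<close>. As \<open>\<psi>\<close> is non-decreasing, the mean value theorem gives
  \<open>F (n + 1) - F n \<ge> b / \<psi> (n + 1)\<close>, and these inequalities telescope.
\<close>

lemma Psi_partial_sums:
  assumes "\<psi> \<in> Psi"
  obtains n1 b where "n1 \<ge> (1::nat)" "b > 0"
    "\<And>N. N \<ge> n1 \<Longrightarrow>
       b * (\<Sum>n\<in>{n1<..N}. 1 / \<psi> (real n)) \<le> real N / \<psi> (real N) - real n1 / \<psi> (real n1)"
proof -
  from assms obtain \<eta> t0 where \<eta>: "\<eta> > 0" and t0: "t0 > 0"
    and C1: "\<psi> C1_differentiable_on {t0<..}"
    and growth: "\<And>t. t > t0 \<Longrightarrow> (1 + \<eta>) * t * deriv \<psi> t \<le> \<psi> t"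
    and pos: "\<And>t. t > 0 \<Longrightarrow> \<psi> t > 0" and mono: "mono_on {0<..} \<psi>"
    unfolding Psi_def by blast
  define b where "b = \<eta> / (1 + \<eta>)"
  have b: "b > 0" using \<eta> by (simp add: b_def)
  have der_psi: "(\<psi> has_real_derivative deriv \<psi> t) (at t)" if "t > t0" for t
  proof -
    from C1 that obtain D where "(\<psi> has_vector_derivative D) (at t)"
      unfolding C1_differentiable_on_def by auto
    then have "(\<psi> has_real_derivative D) (at t)"
      by (simp add: has_real_derivative_iff_has_vector_derivative)
    then show ?thesis using DERIV_imp_deriv by metis
  qed
  define F where "F t = t / \<psi> t" for t
  have der_F: "(F has_real_derivative (\<psi> t - t * deriv \<psi> t) / (\<psi> t)\<^sup>2) (at t)" if "t > t0" for t
  proof -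
    have "\<psi> t \<noteq> 0" using pos[of t] that t0 by simp
    then show ?thesis unfolding F_def
      by (auto intro!: derivative_eq_intros der_psi that simp: power2_eq_square)
  qed
  have der_F_ge: "b / \<psi> t \<le> (\<psi> t - t * deriv \<psi> t) / (\<psi> t)\<^sup>2" if "t > t0" for t
  proof -
    have p: "\<psi> t > 0" using pos that t0 by simp
    have "t * deriv \<psi> t \<le> \<psi> t / (1 + \<eta>)"
      using growth[OF that] \<eta> by (simp add: field_simps)
    moreover have "\<psi> t - \<psi> t / (1 + \<eta>) = b * \<psi> t"
      using \<eta> by (simp add: b_def field_simps)
    ultimately have "b * \<psi> t \<le> \<psi> t - t * deriv \<psi> t" by linarith
    then have "b * \<psi> t / (\<psi> t)\<^sup>2 \<le> (\<psi> t - t * deriv \<psi> t) / (\<psi> t)\<^sup>2"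
      by (rule divide_right_mono) simp
    then show ?thesis using p by (simp add: power2_eq_square)
  qed
  have F_step: "b / \<psi> (t + 1) \<le> F (t + 1) - F t" if "t > t0" for t
  proof -
    \<comment> \<open>\<open>1 / \<psi>\<close> is non-increasing, so its value at the intermediate point is at least the one at
      the right end.\<close>
    have "\<exists>\<xi>>t. \<xi> < t + 1 \<and>
        F (t + 1) - F t = (t + 1 - t) * ((\<psi> \<xi> - \<xi> * deriv \<psi> \<xi>) / (\<psi> \<xi>)\<^sup>2)"
      by (rule MVT2) (use der_F that in auto)
    then obtain \<xi> where \<xi>: "t < \<xi>" "\<xi> < t + 1"
      and eq: "F (t + 1) - F t = (\<psi> \<xi> - \<xi> * deriv \<psi> \<xi>) / (\<psi> \<xi>)\<^sup>2"
      by auto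
    have "\<psi> \<xi> \<le> \<psi> (t + 1)"
      using mono_onD[OF mono, of \<xi> "t + 1"] \<xi> that t0 by simp
    moreover have "\<psi> \<xi> > 0" using pos \<xi> that t0 by simp
    ultimately have "b / \<psi> (t + 1) \<le> b / \<psi> \<xi>"
      using b by (intro divide_left_mono) auto
    also have "\<dots> \<le> F (t + 1) - F t"
      using der_F_ge[of \<xi>] \<xi> that eq by simp
    finally show ?thesis .
  qed
  define n1 where "n1 = Suc (nat \<lceil>t0\<rceil>)"
  have n1: "real n1 > t0" unfolding n1_def by linarith
  have "b * (\<Sum>n\<in>{n1<..N}. 1 / \<psi> (real n)) \<le> F (real N) - F (real n1)" if "N \<ge> n1" for N
    using that
  proof (induction N rule: dec_induct)
    case base
    show ?case by simp
  next
    case (step N)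
    have "{n1<..Suc N} = insert (Suc N) {n1<..N}" using step.hyps by auto
    then have "b * (\<Sum>n\<in>{n1<..Suc N}. 1 / \<psi> (real n))
        = b / \<psi> (real N + 1) + b * (\<Sum>n\<in>{n1<..N}. 1 / \<psi> (real n))"
      by (simp add: algebra_simps)
    also have "\<dots> \<le> (F (real N + 1) - F (real N)) + (F (real N) - F (real n1))"
      using F_step[of "real N"] step n1 by (intro add_mono) auto
    finally show ?case by (simp add: add.commute)
  qed
  then show ?thesis
    using that[of n1 b] b unfolding F_def by (simp add: n1_def)
qed

text \<open>
  The bound on \<open>a\<close> and the telescoping estimate hold only for large indices. The sum \<open>K\<close> of the
  remaining terms is absorbed because \<open>N / \<psi> N\<close> is at least a positive constant \<open>q\<close>, its value at
  the index where the telescoping starts.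
\<close>

lemma Psi_sum_bound:
  fixes a :: "nat \<Rightarrow> real"
  assumes \<psi>: "\<psi> \<in> Psi" and c: "c > 0"
    and a: "\<forall>\<^sub>F n in sequentially. a n \<le> c / \<psi> (real n)"
  obtains C where "C \<ge> 0" "\<forall>\<^sub>F N in sequentially. (\<Sum>n\<le>N. a n) \<le> C * (real N / \<psi> (real N))"
proof -
  have pos: "\<psi> t > 0" if "t > 0" for t using \<psi> that unfolding Psi_def by blast
  from Psi_partial_sums[OF \<psi>] obtain n1 b where n1: "n1 \<ge> 1" and b: "b > 0"
    and sums: "\<And>N. N \<ge> n1 \<Longrightarrow>
       b * (\<Sum>n\<in>{n1<..N}. 1 / \<psi> (real n)) \<le> real N / \<psi> (real N) - real n1 / \<psi> (real n1)"
    by blast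
  from a obtain n0 where n0: "\<And>n. n \<ge> n0 \<Longrightarrow> a n \<le> c / \<psi> (real n)"
    unfolding eventually_sequentially by blast
  define m where "m = max n0 n1"
  define K where "K = (\<Sum>n\<le>m. \<bar>a n\<bar>)"
  define q where "q = real n1 / \<psi> (real n1)"
  have q: "q > 0" using n1 pos[of "real n1"] by (simp add: q_def)
  have K: "K \<ge> 0" unfolding K_def by (rule sum_nonneg) simp
  have "(\<Sum>n\<le>N. a n) \<le> (K / q + c / b) * (real N / \<psi> (real N))" if N: "N \<ge> m" for N
  proof -
    have tail_nonneg: "0 \<le> (\<Sum>n\<in>{n1<..N}. 1 / \<psi> (real n))"
      by (rule sum_nonneg) (use pos in \<open>auto intro: less_imp_le\<close>)
    have bound: "b * (\<Sum>n\<in>{n1<..N}. 1 / \<psi> (real n)) \<le> real N / \<psi> (real N) - q"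
      using sums[of N] N unfolding m_def q_def by simp
    then have "q \<le> real N / \<psi> (real N)"
      using mult_nonneg_nonneg[OF less_imp_le[OF b] tail_nonneg] by linarith
    then have head: "K \<le> K / q * (real N / \<psi> (real N))"
      using mult_left_mono[of q "real N / \<psi> (real N)" "K / q"] q K by simp
    have "(\<Sum>n\<in>{n1<..N}. 1 / \<psi> (real n)) \<le> (real N / \<psi> (real N)) / b"
      using bound q b by (simp add: field_simps del: divide_divide_eq_left divide_divide_eq_right)
    from mult_left_mono[OF this less_imp_le[OF c]]
    have tail: "c * (\<Sum>n\<in>{n1<..N}. 1 / \<psi> (real n)) \<le> c / b * (real N / \<psi> (real N))"
      by (simp add: mult.commute)
    have "{..N} = {..m} \<union> {m<..N}" using N by auto
    then have "(\<Sum>n\<le>N. a n) = (\<Sum>n\<le>m. a n) + (\<Sum>n\<in>{m<..N}. a n)"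
      by (simp add: sum.union_disjoint ivl_disj_int)
    also have "(\<Sum>n\<le>m. a n) \<le> K" unfolding K_def by (rule sum_mono) simp
    also have "(\<Sum>n\<in>{m<..N}. a n) \<le> (\<Sum>n\<in>{m<..N}. c / \<psi> (real n))"
      by (rule sum_mono) (use n0 in \<open>auto simp: m_def\<close>)
    also have "\<dots> \<le> (\<Sum>n\<in>{n1<..N}. c / \<psi> (real n))"
    proof (rule sum_mono2)
      show "{m<..N} \<subseteq> {n1<..N}" by (auto simp: m_def)
      show "0 \<le> c / \<psi> (real n)" if "n \<in> {n1<..N} - {m<..N}" for n
        using that c pos[of "real n"] by simp
    qed simp
    also have "\<dots> = c * (\<Sum>n\<in>{n1<..N}. 1 / \<psi> (real n))"
      by (simp add: sum_distrib_left)
    finally show ?thesis using head tail unfolding distrib_right by linarith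
  qed
  then have "\<forall>\<^sub>F N in sequentially. (\<Sum>n\<le>N. a n) \<le> (K / q + c / b) * (real N / \<psi> (real N))"
    unfolding eventually_sequentially by blast
  moreover have "K / q + c / b \<ge> 0" using K q c b by simp
  ultimately show ?thesis using that by blast
qed

text \<open>
  The base in condition (IV) cannot be 1, since the series would then have constant positive terms;
  a base of at least 2 is what makes its powers a usable scale.
\<close>

lemma Psi_starE:
  assumes "\<psi> \<in> Psi_star"
  obtains \<gamma> :: nat where "\<psi> \<in> Psi" "\<gamma> \<ge> 2" "summable (\<lambda>k. 1 / \<psi> (real (\<gamma> ^ k)))"
proof -
  from assms obtain \<gamma> :: nat where \<psi>: "\<psi> \<in> Psi" and "\<gamma> \<ge> 1"
    and sm: "summable (\<lambda>n. 1 / \<psi> (real (\<gamma> ^ Suc n)))"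
    unfolding Psi_star_def by blast
  have "\<gamma> \<noteq> 1"
  proof
    assume "\<gamma> = 1"
    then have "(\<lambda>n::nat. 1 / \<psi> 1) \<longlonglongrightarrow> 0"
      using summable_LIMSEQ_zero[OF sm] by simp
    then have "1 / \<psi> 1 = 0" by (simp add: LIMSEQ_const_iff)
    moreover have "\<psi> 1 > 0" using \<psi> unfolding Psi_def by simp
    ultimately show False by simp
  qed
  moreover have "summable (\<lambda>k. 1 / \<psi> (real (\<gamma> ^ k)))"
    using sm summable_Suc_iff[of "\<lambda>k. 1 / \<psi> (real (\<gamma> ^ k))"] by simp
  ultimately show ?thesis using that[of \<gamma>] \<psi> \<open>\<gamma> \<ge> 1\<close> by linarith
qed

section \<open>Densities along geometric scales\<close>

text \<open>
  If \<open>\<gamma> ^ k \<le> N < \<gamma> ^ (k + 1)\<close>, then \<open>A\<close> has no more elements up to \<open>N\<close> than up to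
  \<open>\<gamma> ^ (k + 1)\<close>, and \<open>\<gamma> ^ (k + 1)\<close> is at most \<open>\<gamma>\<close> times \<open>N\<close>.
\<close>

lemma density_zero_from_powers:
  fixes A :: "nat set" and \<gamma> :: nat
  assumes \<gamma>: "\<gamma> \<ge> 2"
    and lim: "(\<lambda>k. real (card (A \<inter> {..\<gamma> ^ k})) / real (\<gamma> ^ k)) \<longlonglongrightarrow> 0"
  shows "upper_density A = 0"
proof -
  have "(\<lambda>N. real (card (A \<inter> {0..N})) / real (N + 1)) \<longlonglongrightarrow> 0"
  proof (rule LIMSEQ_I)
    fix \<epsilon> :: real assume \<epsilon>: "\<epsilon> > 0"
    then have "\<epsilon> / real \<gamma> > 0" using \<gamma> by simp
    from LIMSEQ_D[OF lim this] obtain K where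
      K: "\<And>k. k \<ge> K \<Longrightarrow> real (card (A \<inter> {..\<gamma> ^ k})) / real (\<gamma> ^ k) < \<epsilon> / real \<gamma>"
      by auto
    have "real (card (A \<inter> {0..N})) / real (N + 1) < \<epsilon>" if N: "N \<ge> \<gamma> ^ K" for N
    proof -
      have "N \<ge> 1" using N \<gamma> by (meson le_trans one_le_power one_le_numeral)
      then obtain k where k: "\<gamma> ^ k \<le> N" "N < \<gamma> ^ (k + 1)"
        using ex_power_ivl1[of \<gamma> N] \<gamma> by auto
      have "\<gamma> ^ K < \<gamma> ^ (k + 1)" using N k by linarith
      then have "Suc k \<ge> K"
        using \<gamma> power_strict_increasing_iff[of \<gamma> K "k + 1"] by linarith
      have "real (card (A \<inter> {0..N})) \<le> real (card (A \<inter> {..\<gamma> ^ Suc k}))"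
        using k by (intro of_nat_mono card_mono) auto
      also have "\<dots> < \<epsilon> / real \<gamma> * real (\<gamma> ^ Suc k)"
        using K[OF \<open>Suc k \<ge> K\<close>] \<gamma> by (subst (asm) pos_divide_less_eq) auto
      also have "\<dots> = \<epsilon> * real (\<gamma> ^ k)" using \<gamma> by simp
      also have "\<dots> \<le> \<epsilon> * real (N + 1)"
        using k \<epsilon> by (intro mult_left_mono of_nat_mono) auto
      finally show ?thesis by (simp add: divide_less_eq)
    qed
    then show "\<exists>N0. \<forall>N\<ge>N0. norm (real (card (A \<inter> {0..N})) / real (N + 1) - 0) < \<epsilon>"
      by (intro exI[of _ "\<gamma> ^ K"]) auto
  qed
  then have "(\<lambda>N. ereal (real (card (A \<inter> {0..N})) / real (N + 1))) \<longlonglongrightarrow> ereal 0"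
    by (rule tendsto_ereal)
  then show ?thesis
    unfolding upper_density_def using lim_imp_Limsup[OF sequentially_bot]
    by (metis zero_ereal_def)
qed

text \<open>
  A first moment argument: the sum over \<open>k\<close> of the proportions of \<open>n \<le> \<gamma> ^ k\<close> with
  \<open>x \<in> A n\<close> has finite integral, so it is finite for almost every \<open>x\<close>, and then its terms tend
  to zero.
\<close>

lemma (in finite_measure) AE_upper_density_zero:
  fixes A :: "nat \<Rightarrow> 'a set" and \<gamma> :: nat
  assumes A: "\<And>n. A n \<in> sets M" and \<gamma>: "\<gamma> \<ge> 2"
    and sm: "summable (\<lambda>k. (\<Sum>n\<le>\<gamma> ^ k. measure M (A n)) / real (\<gamma> ^ k))"
  shows "AE x in M. upper_density {n. x \<in> A n} = 0"
proof -
  define S where "S k x = (\<Sum>n\<le>\<gamma> ^ k. indicator (A n) x :: real) / real (\<gamma> ^ k)" for k x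
  have S_nonneg: "S k x \<ge> 0" for k x
    unfolding S_def by (intro divide_nonneg_nonneg sum_nonneg) auto
  have S_meas [measurable]: "S k \<in> borel_measurable M" for k
    unfolding S_def using A by measurable
  have S_int: "integrable M (S k)" for k
    unfolding S_def using A by (auto simp: emeasure_eq_measure)
  have S_exp: "(\<integral>x. S k x \<partial>M) = (\<Sum>n\<le>\<gamma> ^ k. measure M (A n)) / real (\<gamma> ^ k)" for k
    unfolding S_def using A by (simp add: emeasure_eq_measure)
  have "(\<integral>\<^sup>+x. (\<Sum>k. ennreal (S k x)) \<partial>M) = (\<Sum>k. \<integral>\<^sup>+x. ennreal (S k x) \<partial>M)"
    by (rule nn_integral_suminf) measurable
  also have "\<dots> = (\<Sum>k. ennreal ((\<Sum>n\<le>\<gamma> ^ k. measure M (A n)) / real (\<gamma> ^ k)))"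
    using S_int S_nonneg by (simp add: nn_integral_eq_integral S_exp)
  also have "\<dots> = ennreal (\<Sum>k. (\<Sum>n\<le>\<gamma> ^ k. measure M (A n)) / real (\<gamma> ^ k))"
    by (rule suminf_ennreal2[OF _ sm]) (intro divide_nonneg_nonneg sum_nonneg; simp)
  also have "\<dots> \<noteq> \<infinity>" by simp
  finally have "AE x in M. (\<Sum>k. ennreal (S k x)) \<noteq> \<infinity>"
    by (intro nn_integral_noteq_infinite) measurable
  then show ?thesis
  proof eventually_elim
    case (elim x)
    then have "summable (\<lambda>k. S k x)"
      using summable_suminf_not_top[of "\<lambda>k. S k x"] S_nonneg by simp
    then have "(\<lambda>k. S k x) \<longlonglongrightarrow> 0" by (rule summable_LIMSEQ_zero)
    moreover have "S k x = real (card ({n. x \<in> A n} \<inter> {..\<gamma> ^ k})) / real (\<gamma> ^ k)" for k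
      unfolding S_def by (simp add: indicator_def of_bool_def sum.If_cases Int_commute Collect_conj_eq)
    ultimately show ?case using density_zero_from_powers[OF \<gamma>, of "{n. x \<in> A n}"] by simp
  qed
qed

section \<open>Visits of density zero for almost every parameter\<close>

theorem theorem3p12:
  fixes \<Lambda> :: "(real ^ 'd) set"
    and \<mm> :: "(real ^ 'd) measure"
    and smul :: "'k::real_normed_field \<Rightarrow> 'a::{ab_group_add, complete_space} \<Rightarrow> 'a"
    and T :: "real ^ 'd \<Rightarrow> 'a \<Rightarrow> 'a"
    and \<psi> :: "real \<Rightarrow> real"
  assumes "\<Lambda> \<in> sets borel"
    and "sets \<mm> = sets borel"
    and "0 < emeasure \<mm> \<Lambda>" and "emeasure \<mm> \<Lambda> < \<infinity>"
    and "F_space smul"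
    and "separable_space (euclidean :: 'a topology)"
    and "\<And>l. l \<in> \<Lambda> \<Longrightarrow> operator_on smul (T l)"
    and "\<And>u. continuous_on \<Lambda> (\<lambda>l. T l u)"
    and "\<psi> \<in> Psi_star"
    and "\<And>u. \<exists>V c. open V \<and> V \<noteq> {} \<and> c > 0 \<and>
           (\<forall>\<^sub>F n in sequentially.
              emeasure \<mm> {l \<in> \<Lambda>. n \<in> visit_times (T l) u V} \<le> ennreal (c / \<psi> (real n)))"
  shows "\<not> (\<exists>u. common_upper_frequently_hypercyclic \<Lambda> T u)"
proof
  assume "\<exists>u. common_upper_frequently_hypercyclic \<Lambda> T u"
  then obtain u where u: "common_upper_frequently_hypercyclic \<Lambda> T u" ..
  from assms(10)[of u] obtain V c where V: "open V" "V \<noteq> {}" and c: "c > 0"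
    and visit: "\<forall>\<^sub>F n in sequentially.
              emeasure \<mm> {l \<in> \<Lambda>. n \<in> visit_times (T l) u V} \<le> ennreal (c / \<psi> (real n))"
    by blast
  from Psi_starE[OF assms(9)] obtain \<gamma> :: nat where \<psi>: "\<psi> \<in> Psi" and \<gamma>: "\<gamma> \<ge> 2"
    and sm: "summable (\<lambda>k. 1 / \<psi> (real (\<gamma> ^ k)))" by blast
  have pos: "\<psi> t > 0" if "t > 0" for t using \<psi> that unfolding Psi_def by blast
  obtain D :: "'a set" where D: "countable D" "closure D = UNIV"
    using assms(6) unfolding separable_space_def by auto
  define M where "M = restrict_space \<mm> \<Lambda>"
  have \<Lambda>: "\<Lambda> \<inter> space \<mm> \<in> sets \<mm>" using assms(1,2) sets_eq_imp_space_eq[OF assms(2)] by simp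
  have space_M: "space M = \<Lambda>"
    using sets_eq_imp_space_eq[OF assms(2)] by (simp add: M_def space_restrict_space)
  have sets_M: "sets M = sets (restrict_space borel \<Lambda>)"
    unfolding M_def by (rule sets_restrict_space_cong[OF assms(2)])
  have em_M: "emeasure M B = emeasure \<mm> B" if "B \<subseteq> \<Lambda>" for B
    unfolding M_def by (rule emeasure_restrict_space[OF \<Lambda> that])
  interpret M: finite_measure M
    by (rule finite_measureI) (use assms(4) in \<open>simp add: space_M em_M\<close>)
  define A where "A n = {l \<in> \<Lambda>. n \<in> visit_times (T l) u V}" for n
  have A_sets: "A n \<in> sets M" for n
  proof -
    have "(\<lambda>l. T l x) \<in> borel_measurable M" for x
      using borel_measurable_continuous_on_restrict[OF assms(8)[of x]]
      by (simp cong: measurable_cong_sets add: sets_M)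
    moreover have "continuous_on UNIV (T l)" if "l \<in> space M" for l
      using assms(7) that by (simp add: operator_on_def space_M)
    ultimately have "(\<lambda>l. (T l ^^ n) u) \<in> borel_measurable M"
      by (rule borel_measurable_iterates[OF D])
    then have "(\<lambda>l. (T l ^^ n) u) -` V \<inter> space M \<in> sets M"
      by (rule measurable_sets) (use V in simp)
    also have "(\<lambda>l. (T l ^^ n) u) -` V \<inter> space M = A n"
      by (auto simp: A_def visit_times_def space_M)
    finally show ?thesis .
  qed
  have "\<forall>\<^sub>F n in sequentially. measure M (A n) \<le> c / \<psi> (real n)"
    using visit eventually_gt_at_top[of 0]
  proof eventually_elim
    case (elim n)
    then have "ennreal (measure M (A n)) \<le> ennreal (c / \<psi> (real n))"
      using em_M[of "A n"] by (simp add: A_def flip: M.emeasure_eq_measure)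
    moreover have "0 \<le> c / \<psi> (real n)"
      using c pos[of "real n"] elim by simp
    ultimately show ?case by (simp add: ennreal_le_iff)
  qed
  from Psi_sum_bound[OF \<psi> c this] obtain C where "C \<ge> 0" and
    C: "\<forall>\<^sub>F N in sequentially. (\<Sum>n\<le>N. measure M (A n)) \<le> C * (real N / \<psi> (real N))"
    by blast
  \<comment> \<open>Sampling at \<open>N = \<gamma> ^ k\<close> and dividing by \<open>N\<close> turns the bound into the series of
    condition (IV).\<close>
  have "filterlim (\<lambda>k. \<gamma> ^ k) at_top sequentially"
    using \<gamma> by (intro filterlim_subseq) (auto simp: strict_mono_def)
  then have ev: "\<forall>\<^sub>F k in sequentially.
      (\<Sum>n\<le>\<gamma> ^ k. measure M (A n)) \<le> C * (real (\<gamma> ^ k) / \<psi> (real (\<gamma> ^ k)))"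
    by (rule eventually_compose_filterlim[OF C])
  have "summable (\<lambda>k. (\<Sum>n\<le>\<gamma> ^ k. measure M (A n)) / real (\<gamma> ^ k))"
  proof (rule summable_comparison_test_ev)
    show "summable (\<lambda>k. C * (1 / \<psi> (real (\<gamma> ^ k))))"
      using sm by (rule summable_mult)
    show "\<forall>\<^sub>F k in sequentially. norm ((\<Sum>n\<le>\<gamma> ^ k. measure M (A n)) / real (\<gamma> ^ k))
        \<le> C * (1 / \<psi> (real (\<gamma> ^ k)))"
      using ev
    proof eventually_elim
      case (elim k)
      have "real (\<gamma> ^ k) > 0" using \<gamma> by simp
      moreover have "(\<Sum>n\<le>\<gamma> ^ k. measure M (A n)) \<ge> 0" by (simp add: sum_nonneg)
      ultimately show ?case using elim
        by (simp add: pos_divide_le_eq del: of_nat_power)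
    qed
  qed
  from M.AE_upper_density_zero[OF A_sets \<gamma> this]
  have zero_density: "AE l in M. upper_density {n. l \<in> A n} = 0" .
  have pos_density: "upper_density {n. l \<in> A n} > 0" if "l \<in> space M" for l
  proof -
    have "{n. l \<in> A n} = visit_times (T l) u V"
      using that by (simp add: A_def space_M)
    then show ?thesis
      using u V that
      unfolding common_upper_frequently_hypercyclic_def upper_frequently_hypercyclic_def
      by (simp add: space_M)
  qed
  have "AE l in M. False"
    using zero_density by (rule AE_mp) (rule AE_I2, use pos_density in force)
  then have "emeasure M (space M) = 0"
    using AE_iff_measurable[of "space M" M "\<lambda>_. False"] by simp
  then show False using assms(3) by (simp add: space_M em_M)
qed

end
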